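(* Let $\epsilon>0$ and $\delta>0$ be given, let $M$ and $W$ be positive integers, and let $\omega_1,\ldots,\omega_{M+W}$ be i.i.d. samples drawn from the uncertainty distribution $\mathbb{P}_\omega$. Let $\mathcal{A}_i$ denote the optimal basis of the OPF problem for the realization $\omega_i$, $i=1,\ldots,M+W$. Let $\mathcal{U}_M=\mathcal{B}\setminus\bigcup_{i=1}^{M}\{\mathcal{A}_i\}$ be the set of bases not observed in the first $M$ samples, let $\pi(\mathcal{U}_M)$ be its probability mass, and let $\mathcal{R}_W=\frac1W\sum_{i=1}^{W}X_i$ be the rate of discovery, where $X_i=1$ if $\mathcal{A}_{M+i}\notin\{\mathcal{A}_1\}\cup\cdots\cup\{\mathcal{A}_M\}$ and $X_i=0$ otherwise. If $$W>\frac{8}{\epsilon}\log\frac{1}{\delta},$$ then $$\mathbb{P}\left(\mathcal{R}_W<\frac{\epsilon}{2}\;\Big|\;\pi(\mathcal{U}_M)>\epsilon\right)<\delta.$$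
   Context: **OPF problem.** Fix positive integers $n$ (generators), $v$ (buses), $m$ (lines), vectors $c,p^{\min},p^{\max}\in\mathbb{R}^n$, $f^{\min},f^{\max}\in\mathbb{R}^m$, $\mu,d\in\mathbb{R}^v$, and matrices $H\in\mathbb{R}^{v\times n}$, $\Phi\in\mathbb{R}^{m\times v}$. Let $e$ denote the all-ones vector of the appropriate dimension. For a realization $\omega\in\mathbb{R}^v$ of the uncertainty, the DC optimal power flow (OPF) problem is the linear program $$\min_{p\in\mathbb{R}^n} c^\top p\quad\text{s.t. } p\in\mathcal{P}(\omega),$$ where $\mathcal{P}(\omega)$ is the set of $p\in\mathbb{R}^n$ satisfying $p^{\min}\le p\le p^{\max}$, $f^{\min}\le \Phi(Hp+\mu+\omega-d)\le f^{\max}$, and $e^\top p=e^\top(d-\mu-\omega)$. Let $\mathcal{P}^*(\omega)$ be its set of minimizers. Attention is restricted to recoverable realizations, i.e. $\omega\in\Omega^R=\{\omega:\mathcal{P}^*(\omega)\ne\emptyset\}$; the random variable $\omega$ has a probability distribution $\mathbb{P}_\omega$ on $\Omega^R$. **Bases.** Write $\mathcal{P}(\omega)=\{p: Ap\le b+C\omega,\ e^\top p=e^\top(d-\mu-\omega)\}$, where the $2(n+m)$ rows of $A$ are those of $I,-I,\Phi H,-\Phi H$ stacked in this order; correspondingly $b$ stacks $p^{\max},\,-p^{\min},\,f^{\max}-\Phi(\mu-d),\,-f^{\min}+\Phi(\mu-d)$ and $C$ stacks $0,0,-\Phi,\Phi$. A basis is a set $\mathcal{A}$ of $n-1$ row indices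 of $A$ such that the $n\times n$ matrix $B=\begin{bmatrix}A_{\mathcal{A}}\\ e^\top\end{bmatrix}$ is invertible, where $A_{\mathcal{A}}$ is the submatrix of rows indexed by $\mathcal{A}$. Let $\mathcal{B}$ be the (finite) set of all bases. The basis policy of $\mathcal{A}$ is $$\rho^{\mathcal{A}}(\omega)=B^{-1}\begin{bmatrix} b_{\mathcal{A}}+C_{\mathcal{A}}\omega\\ e^\top(d-\mu-\omega)\end{bmatrix},$$ and $\mathcal{A}$ is optimal for $\omega$ if $\rho^{\mathcal{A}}(\omega)\in\mathcal{P}^*(\omega)$. Every $\omega\in\Omega^R$ has at least one optimal basis. If there are several, a fixed (measurable) tie-breaking rule selects one as a function of $\omega$; this selected basis is called "the optimal basis" for $\omega$. **Probability of bases.** For $\mathcal{A}\in\mathcal{B}$, $\pi(\mathcal{A})$ is the probability under $\mathbb{P}_\omega$ that $\mathcal{A}$ is the optimal basis for $\omega$. For $\mathcal{U}\subseteq\mathcal{B}$, $\pi(\mathcal{U})=\sum_{\mathcal{A}\in\mathcal{U}}\pi(\mathcal{A})$. **Conventions.** $\log$ is the natural logarithm. $\mathbb{P}$ is the joint law of the samples $\omega_1,\ldots,\omega_{M+W}$. The conditional probability is considered when the conditioning event $\{\pi(\mathcal{U}_M)>\epsilon\}$ has positive probability. *)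

theory Defs
  imports "HOL-Probability.Probability"
begin

text \<open>
  Generators, buses and lines are indexed by the finite types \<open>'n\<close>, \<open>'v\<close>, \<open>'m\<close>; such types are
  nonempty, so their numbers are positive.  The all-ones vector \<open>e\<close> is \<open>1 :: real ^ 'k\<close>, and
  \<open>\<le>\<close> on vectors is componentwise.
\<close>

record ('n::finite, 'v::finite, 'm::finite) opf =
  cost   :: "real ^ 'n"        \<comment> \<open>\<open>c\<close>\<close>
  p_min  :: "real ^ 'n"
  p_max  :: "real ^ 'n"
  f_min  :: "real ^ 'm"
  f_max  :: "real ^ 'm"
  infeed :: "real ^ 'v"        \<comment> \<open>\<open>\<mu>\<close>\<close>
  load   :: "real ^ 'v"        \<comment> \<open>\<open>d\<close>\<close>
  gen_bus :: "real ^ 'n ^ 'v"  \<comment> \<open>\<open>H\<close>\<close>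
  ptdf   :: "real ^ 'v ^ 'm"   \<comment> \<open>\<open>\<Phi>\<close>\<close>

definition feasible :: "('n::finite, 'v::finite, 'm::finite) opf \<Rightarrow> real ^ 'v \<Rightarrow> (real ^ 'n) set" where
  "feasible G \<omega> = {p. p_min G \<le> p \<and> p \<le> p_max G
     \<and> f_min G \<le> ptdf G *v (gen_bus G *v p + infeed G + \<omega> - load G)
     \<and> ptdf G *v (gen_bus G *v p + infeed G + \<omega> - load G) \<le> f_max G
     \<and> 1 \<bullet> p = 1 \<bullet> (load G - infeed G - \<omega>)}"

definition minimizers :: "('n::finite, 'v::finite, 'm::finite) opf \<Rightarrow> real ^ 'v \<Rightarrow> (real ^ 'n) set" where
  "minimizers G \<omega> = {p \<in> feasible G \<omega>. \<forall>q \<in> feasible G \<omega>. cost G \<bullet> p \<le> cost G \<bullet> q}"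

definition recoverable :: "('n::finite, 'v::finite, 'm::finite) opf \<Rightarrow> (real ^ 'v) set" where
  "recoverable G = {\<omega>. minimizers G \<omega> \<noteq> {}}"


text \<open>
  Vertical stacking of vectors; a matrix being a vector of rows, it also stacks matrices.
\<close>

definition stack :: "'a ^ 'k::finite \<Rightarrow> 'a ^ 'l::finite \<Rightarrow> 'a ^ ('k + 'l)" where
  "stack X Y = (\<chi> r. case r of Inl i \<Rightarrow> X $ i | Inr j \<Rightarrow> Y $ j)"

type_synonym ('n, 'm) ineq = "'n + 'n + 'm + 'm"

definition A_mat :: "('n::finite, 'v::finite, 'm::finite) opf \<Rightarrow> real ^ 'n ^ ('n, 'm) ineq" where
  "A_mat G = stack (mat 1) (stack (- mat 1)
     (stack (ptdf G ** gen_bus G) (- (ptdf G ** gen_bus G))))"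

definition b_vec :: "('n::finite, 'v::finite, 'm::finite) opf \<Rightarrow> real ^ ('n, 'm) ineq" where
  "b_vec G = stack (p_max G) (stack (- p_min G)
     (stack (f_max G - ptdf G *v (infeed G - load G)) (- f_min G + ptdf G *v (infeed G - load G))))"

definition C_mat :: "('n::finite, 'v::finite, 'm::finite) opf \<Rightarrow> real ^ 'v ^ ('n, 'm) ineq" where
  "C_mat G = stack 0 (stack 0 (stack (- ptdf G) (ptdf G)))"

lemma feasible_eq_A_mat:
  "feasible G \<omega> = {p. A_mat G *v p \<le> b_vec G + C_mat G *v \<omega> \<and> 1 \<bullet> p = 1 \<bullet> (load G - infeed G - \<omega>)}"
proof -
  have *: "(A_mat G *v p \<le> b_vec G + C_mat G *v \<omega>) \<longleftrightarrow> p_min G \<le> p \<and> p \<le> p_max G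
     \<and> f_min G \<le> ptdf G *v (gen_bus G *v p + infeed G + \<omega> - load G)
     \<and> ptdf G *v (gen_bus G *v p + infeed G + \<omega> - load G) \<le> f_max G" for p
  proof -
    have s: "stack X Y *v x = stack (X *v x) (Y *v x)"
      for X :: "real ^ 'x ^ 'k::finite" and Y :: "real ^ 'x ^ 'l::finite" and x
      by (auto simp: vec_eq_iff stack_def matrix_vector_mult_def split: sum.split)
    have p: "stack x y + stack x' y' = stack (x + x') (y + y')"
      for x x' :: "real ^ 'k::finite" and y y' :: "real ^ 'l::finite"
      by (auto simp: vec_eq_iff stack_def split: sum.split)
    have l: "stack x y \<le> stack x' y' \<longleftrightarrow> x \<le> x' \<and> y \<le> y'"
      for x x' :: "real ^ 'k::finite" and y y' :: "real ^ 'l::finite"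
      by (auto simp: less_eq_vec_def stack_def split: sum.split sum.splits)
    have m: "(- X) *v x = - (X *v x)" for X :: "real ^ 'x ^ 'k::finite" and x
      by (simp add: vec_eq_iff matrix_vector_mult_def sum_negf)
    show ?thesis
      unfolding A_mat_def b_vec_def C_mat_def s p l m matrix_vector_mul_assoc[symmetric]
      by (auto simp: matrix_vector_right_distrib matrix_vector_mult_diff_distrib less_eq_vec_def algebra_simps)
  qed
  show ?thesis unfolding feasible_def * by auto
qed

text \<open>
  The rows of the basis matrix are those of \<open>A\<close> indexed by a set \<open>\<A>\<close>, followed by \<open>e\<^sup>T\<close>; in the full
  system the latter has the index \<open>Inr ()\<close>.  A square matrix \<open>real ^ 'n ^ 'n\<close> has its rows indexed by
  \<open>'n\<close>, so the rows are listed by some bijection from \<open>'n\<close>.  The lemmas below show that neither the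
  notion of basis nor the basis policy depends on it.
\<close>

definition basis_rows :: "('n::finite, 'm::finite) ineq set \<Rightarrow> (('n, 'm) ineq + unit) set" where
  "basis_rows \<A> = insert (Inr ()) (Inl ` \<A>)"

definition row_enum :: "('n::finite, 'm::finite) ineq set \<Rightarrow> 'n \<Rightarrow> ('n, 'm) ineq + unit" where
  "row_enum \<A> = (SOME \<sigma>. bij_betw \<sigma> UNIV (basis_rows \<A>))"

definition system_mat :: "('n::finite, 'v::finite, 'm::finite) opf \<Rightarrow> real ^ 'n ^ (('n, 'm) ineq + unit)" where
  "system_mat G = stack (A_mat G) (\<chi> _. 1)"

definition system_rhs ::
  "('n::finite, 'v::finite, 'm::finite) opf \<Rightarrow> real ^ 'v \<Rightarrow> real ^ (('n, 'm) ineq + unit)" where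
  "system_rhs G \<omega> = stack (b_vec G + C_mat G *v \<omega>) (\<chi> _. 1 \<bullet> (load G - infeed G - \<omega>))"

definition basis_mat ::
  "('n::finite, 'v::finite, 'm::finite) opf \<Rightarrow> ('n, 'm) ineq set \<Rightarrow> real ^ 'n ^ 'n" where
  "basis_mat G \<A> = (\<chi> i. system_mat G $ row_enum \<A> i)"

definition basis_rhs ::
  "('n::finite, 'v::finite, 'm::finite) opf \<Rightarrow> ('n, 'm) ineq set \<Rightarrow> real ^ 'v \<Rightarrow> real ^ 'n" where
  "basis_rhs G \<A> \<omega> = (\<chi> i. system_rhs G \<omega> $ row_enum \<A> i)"

definition bases :: "('n::finite, 'v::finite, 'm::finite) opf \<Rightarrow> ('n, 'm) ineq set set" where
  "bases G = {\<A>. card \<A> = CARD('n) - 1 \<and> invertible (basis_mat G \<A>)}"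

definition policy ::
  "('n::finite, 'v::finite, 'm::finite) opf \<Rightarrow> ('n, 'm) ineq set \<Rightarrow> real ^ 'v \<Rightarrow> real ^ 'n" where
  "policy G \<A> \<omega> = matrix_inv (basis_mat G \<A>) *v basis_rhs G \<A> \<omega>"

lemma row_enum_bij:
  fixes \<A> :: "('n::finite, 'm::finite) ineq set"
  assumes "card \<A> = CARD('n) - 1"
  shows "bij_betw (row_enum \<A>) UNIV (basis_rows \<A>)"
proof -
  have "card (Inl ` \<A> :: (('n, 'm) ineq + unit) set) = CARD('n) - 1"
    using assms by (simp add: card_image)
  moreover have "0 < CARD('n)" by simp
  ultimately have "card (basis_rows \<A>) = CARD('n)"
    unfolding basis_rows_def by (subst card_insert_disjoint) auto
  then have "\<exists>\<sigma> :: 'n \<Rightarrow> _. bij_betw \<sigma> UNIV (basis_rows \<A>)"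
    by (intro finite_same_card_bij) auto
  then show ?thesis unfolding row_enum_def by (rule someI_ex)
qed

lemma basis_mat_enum_indep:
  fixes G :: "('n::finite, 'v::finite, 'm::finite) opf"
  assumes "card \<A> = CARD('n) - 1" and \<sigma>: "bij_betw \<sigma> UNIV (basis_rows \<A>)"
  shows "invertible ((\<chi> i. system_mat G $ \<sigma> i) :: real ^ 'n ^ 'n) \<longleftrightarrow> invertible (basis_mat G \<A>)"
proof -
  have "rows ((\<chi> i. system_mat G $ \<tau> i) :: real ^ 'n ^ 'n) = (\<lambda>r. system_mat G $ r) ` basis_rows \<A>"
    if "bij_betw \<tau> UNIV (basis_rows \<A>)" for \<tau>
  proof -
    have "rows ((\<chi> i. system_mat G $ \<tau> i) :: real ^ 'n ^ 'n) = (\<lambda>r. system_mat G $ r) ` range \<tau>"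
      by (auto simp: rows_def row_def)
    then show ?thesis using that by (simp add: bij_betw_def)
  qed
  from this[OF \<sigma>] this[OF row_enum_bij[OF assms(1)]] show ?thesis
    by (simp add: invertible_left_inverse matrix_left_invertible_span_rows basis_mat_def)
qed

lemma policy_eq_iff:
  fixes G :: "('n::finite, 'v::finite, 'm::finite) opf"
  assumes "\<A> \<in> bases G"
  shows "p = policy G \<A> \<omega> \<longleftrightarrow>
    (\<forall>r\<in>\<A>. (A_mat G *v p) $ r = (b_vec G + C_mat G *v \<omega>) $ r) \<and> 1 \<bullet> p = 1 \<bullet> (load G - infeed G - \<omega>)"
proof -
  let ?B = "basis_mat G \<A>"
  have inv: "invertible ?B" and c: "card \<A> = CARD('n) - 1" using assms by (auto simp: bases_def)
  have "matrix_inv ?B ** ?B = mat 1" "?B ** matrix_inv ?B = mat 1"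
    using someI_ex[OF inv[unfolded invertible_def]] unfolding matrix_inv_def by auto
  then have "p = policy G \<A> \<omega> \<longleftrightarrow> ?B *v p = basis_rhs G \<A> \<omega>"
    unfolding policy_def by (metis matrix_vector_mul_assoc matrix_vector_mul_lid)
  also have "\<dots> \<longleftrightarrow> (\<forall>i. (system_mat G *v p) $ row_enum \<A> i = system_rhs G \<omega> $ row_enum \<A> i)"
    by (simp add: vec_eq_iff basis_mat_def basis_rhs_def matrix_vector_mult_def)
  also have "\<dots> \<longleftrightarrow> (\<forall>r \<in> basis_rows \<A>. (system_mat G *v p) $ r = system_rhs G \<omega> $ r)"
    using row_enum_bij[OF c] by (metis (no_types, lifting) bij_betw_def imageE rangeI)
  also have "\<dots> \<longleftrightarrow> (\<forall>r\<in>\<A>. (A_mat G *v p) $ r = (b_vec G + C_mat G *v \<omega>) $ r) \<and> 1 \<bullet> p = 1 \<bullet> (load G - infeed G - \<omega>)"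
    by (auto simp: basis_rows_def system_mat_def system_rhs_def stack_def matrix_vector_mult_def inner_vec_def)
  finally show ?thesis .
qed


definition optimal_basis ::
  "('n::finite, 'v::finite, 'm::finite) opf \<Rightarrow> real ^ 'v \<Rightarrow> ('n, 'm) ineq set \<Rightarrow> bool" where
  "optimal_basis G \<omega> \<A> \<longleftrightarrow> \<A> \<in> bases G \<and> policy G \<A> \<omega> \<in> minimizers G \<omega>"

definition tie_breaking_rule ::
  "('n::finite, 'v::finite, 'm::finite) opf \<Rightarrow> (real ^ 'v \<Rightarrow> ('n, 'm) ineq set) \<Rightarrow> bool" where
  "tie_breaking_rule G sel \<longleftrightarrow>
     sel \<in> restrict_space borel (recoverable G) \<rightarrow>\<^sub>M count_space UNIV
     \<and> (\<forall>\<omega> \<in> recoverable G. optimal_basis G \<omega> (sel \<omega>))"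

definition uncertainty_distribution ::
  "('n::finite, 'v::finite, 'm::finite) opf \<Rightarrow> (real ^ 'v) measure \<Rightarrow> bool" where
  "uncertainty_distribution G P \<longleftrightarrow>
     prob_space P \<and> sets P = sets (restrict_space borel (recoverable G))"

definition basis_prob ::
  "(real ^ 'v::finite) measure \<Rightarrow> (real ^ 'v \<Rightarrow> ('n::finite, 'm::finite) ineq set) \<Rightarrow> ('n, 'm) ineq set \<Rightarrow> real" where
  "basis_prob P sel \<A> = \<P>(\<omega> in P. sel \<omega> = \<A>)"

definition bases_prob ::
  "(real ^ 'v::finite) measure \<Rightarrow> (real ^ 'v \<Rightarrow> ('n::finite, 'm::finite) ineq set) \<Rightarrow> ('n, 'm) ineq set set \<Rightarrow> real" where
  "bases_prob P sel \<U> = (\<Sum>\<A>\<in>\<U>. basis_prob P sel \<A>)"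

text \<open>
  Below, \<open>w\<close> is a sequence of realizations \<open>\<omega>\<^sub>1, \<omega>\<^sub>2, \<dots>\<close>, of which only the entries up to \<open>M\<close>,
  respectively \<open>M + W\<close>, are used.
\<close>

definition unobserved ::
  "('n::finite, 'v::finite, 'm::finite) opf \<Rightarrow> (real ^ 'v \<Rightarrow> ('n, 'm) ineq set) \<Rightarrow> nat
     \<Rightarrow> (nat \<Rightarrow> real ^ 'v) \<Rightarrow> ('n, 'm) ineq set set" where
  "unobserved G sel M w = bases G - (\<Union>i\<in>{1..M}. {sel (w i)})"

definition discovery_rate ::
  "(real ^ 'v::finite \<Rightarrow> ('n::finite, 'm::finite) ineq set) \<Rightarrow> nat \<Rightarrow> nat \<Rightarrow> (nat \<Rightarrow> real ^ 'v) \<Rightarrow> real" where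
  "discovery_rate sel M W w =
     1 / real W * (\<Sum>i=1..W. if sel (w (M + i)) \<notin> (\<Union>j\<in>{1..M}. {sel (w j)}) then 1 else 0)"

end

theory Submission
  imports Defs
begin

text \<open>
  Only the labels \<open>\<A>\<^sub>i = sel \<omega>\<^sub>i\<close> matter: they are i.i.d. with values in a finite type.  Fix the labels
  seen in the first \<open>M\<close> samples.  The set \<open>\<O>\<close> of observed bases is then a constant, and by
  independence the indicators \<open>X\<^sub>j\<close> of \<open>\<A>\<^sub>M\<^sub>+\<^sub>j \<notin> \<O>\<close> are still i.i.d. Bernoulli variables, with success
  probability \<open>q \<ge> \<pi>(\<B> - \<O>)\<close>, so \<open>q > \<epsilon>\<close> on the conditioning event.  A Chernoff bound for the lower
  tail, with exponential base \<open>1/2\<close>, bounds the probability that \<open>\<Sum>\<^sub>j X\<^sub>j < W * \<epsilon> / 2\<close> by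
  \<open>2 powr (W * \<epsilon> / 2) * (1 - q / 2) ^ W \<le> exp (- W * \<epsilon> * (1 - ln 2) / 2) \<le> exp (- W * \<epsilon> / 8)\<close>,
  the last step because \<open>ln 2 \<le> 3/4\<close>.  This bound is the same for all histories with missing
  mass above \<open>\<epsilon>\<close>, and there are finitely many, so it survives summation over them:
  the joint probability is at most \<open>exp (- W \<epsilon> / 8)\<close> times that of the conditioning event.  The
  hypothesis on \<open>W\<close> says precisely that \<open>exp (- W \<epsilon> / 8) < \<delta>\<close>.

  The estimate for one history is \<open>few_hits_given_history\<close>; the summation is
  \<open>few_discoveries_and_missing_mass\<close>.
\<close>

section \<open>A Chernoff bound for a fixed history\<close>

lemma sets_Collect_in:
  assumes "A \<in> M \<rightarrow>\<^sub>M count_space UNIV"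
  shows "{s\<in>space M. A s \<in> X} \<in> sets M"
  using measurable_sets[OF assms, of X] by (simp add: vimage_def Int_def conj_commute)

lemma sets_Collect_count_less:
  fixes c :: real
  assumes fin: "finite J" and rv: "\<And>j. j \<in> J \<Longrightarrow> A j \<in> M \<rightarrow>\<^sub>M count_space UNIV"
  shows "{s\<in>space M. real (card {j\<in>J. A j s \<in> N}) < c} \<in> sets M"
proof -
  have "(\<lambda>s. \<Sum>j\<in>J. indicator N (A j s) :: real) \<in> borel_measurable M"
    by (intro borel_measurable_sum measurable_compose[OF rv]) auto
  moreover have "(\<Sum>j\<in>J. indicator N (A j s)) = real (card {j\<in>J. A j s \<in> N})" for s
    using fin by (simp add: indicator_def sum.If_cases Int_def)
  ultimately show ?thesis by simp
qed

text \<open>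
  The event \<open>\<forall>i\<in>I. A i s \<in> B i\<close> is the history.  Its indicator is a product of functions of the single
  \<open>A i\<close>, and so is the weight \<open>(1/2) ^ card {j\<in>J. A j s \<in> N}\<close>.  Independence of the whole
  family thus evaluates their joint expectation at once, and Markov's inequality bounds the
  probability of a small count.
\<close>

lemma (in prob_space) few_hits_given_history:
  fixes A :: "'i \<Rightarrow> 'a \<Rightarrow> 'b" and \<epsilon> :: real
  assumes indep: "indep_vars (\<lambda>_. count_space UNIV) A (I \<union> J)"
    and fin: "finite I" "finite J" and disj: "I \<inter> J = {}"
    and hit: "\<And>j. j \<in> J \<Longrightarrow> \<epsilon> \<le> \<P>(s in M. A j s \<in> N)"
  shows "\<P>(s in M. (\<forall>i\<in>I. A i s \<in> B i) \<and> real (card {j\<in>J. A j s \<in> N}) < \<epsilon> / 2 * card J)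
    \<le> exp (- \<epsilon> * card J / 8) * \<P>(s in M. \<forall>i\<in>I. A i s \<in> B i)"
proof (cases "\<epsilon> \<le> 0")
  case True
  then have "\<not> real (card {j\<in>J. A j s \<in> N}) < \<epsilon> / 2 * card J" for s
    using mult_nonpos_nonneg[of "\<epsilon> / 2" "real (card J)"] of_nat_0_le_iff[of "card {j\<in>J. A j s \<in> N}"]
    by linarith
  then show ?thesis by simp
next
  case False
  have rv[measurable]: "A i \<in> M \<rightarrow>\<^sub>M count_space UNIV" if "i \<in> I \<union> J" for i
    using indep that by (auto simp: indep_vars_def)
  have meas: "{s\<in>space M. A i s \<in> X} \<in> events" if "i \<in> I \<union> J" for i X
    using rv[OF that] by (rule sets_Collect_in)
  define f :: "'i \<Rightarrow> 'b \<Rightarrow> real"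
    where "f i x = (if i \<in> I then indicator (B i) x else 1 - indicator N x / 2)" for i x
  have f_rv: "(\<lambda>s. f i (A i s)) \<in> borel_measurable M" if "i \<in> I \<union> J" for i
    using measurable_compose[OF rv[OF that], of "f i" borel] by simp
  have f_bounds: "0 \<le> f i x" "f i x \<le> 1" for i x
    by (auto simp: f_def indicator_def)
  have f_int: "integrable M (\<lambda>s. f i (A i s))" if "i \<in> I \<union> J" for i
    using f_bounds by (intro integrable_const_bound[of _ 1] AE_I2 f_rv that) auto
  have f_indep: "indep_vars (\<lambda>_. borel) (\<lambda>i s. f i (A i s)) (I \<union> J)"
    by (rule indep_vars_compose2[OF indep]) simp
  have ind_eq: "(indicator X (A i s) :: real) = indicator {s\<in>space M. A i s \<in> X} s"
    if "s \<in> space M" for i s X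
    using that by (simp add: indicator_def)
  have E_ind: "expectation (\<lambda>s. indicator X (A i s)) = \<P>(s in M. A i s \<in> X)"
    and int_ind: "integrable M (\<lambda>s. indicator X (A i s) :: real)" if "i \<in> I \<union> J" for i X
  proof -
    have "expectation (\<lambda>s. indicator X (A i s) :: real) = expectation (indicator {s\<in>space M. A i s \<in> X})"
      by (rule Bochner_Integration.integral_cong) (simp_all add: ind_eq)
    also have "\<dots> = \<P>(s in M. A i s \<in> X)" using meas[OF that] by simp
    finally show "expectation (\<lambda>s. indicator X (A i s)) = \<P>(s in M. A i s \<in> X)" .
    have "integrable M (\<lambda>s. indicator {s\<in>space M. A i s \<in> X} s :: real)"
      by (rule integrable_real_indicator) (use meas[OF that] in \<open>auto simp: less_top[symmetric]\<close>)
    then show "integrable M (\<lambda>s. indicator X (A i s) :: real)"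
      by (subst Bochner_Integration.integrable_cong[OF refl ind_eq]) auto
  qed

  have history: "(\<Prod>i\<in>I. expectation (\<lambda>s. f i (A i s))) = \<P>(s in M. \<forall>i\<in>I. A i s \<in> B i)"
  proof (cases "I = {}")
    case True
    then show ?thesis by (simp add: prob_space)
  next
    case False
    have "(\<Prod>i\<in>I. expectation (\<lambda>s. f i (A i s))) = (\<Prod>i\<in>I. prob (A i -` B i \<inter> space M))"
      using E_ind by (intro prod.cong) (auto simp: f_def vimage_def Int_def conj_commute)
    also have "\<dots> = prob (\<Inter>i\<in>I. A i -` B i \<inter> space M)"
      using False fin(1) by (intro indep_varsD[OF indep, symmetric]) auto
    also have "(\<Inter>i\<in>I. A i -` B i \<inter> space M) = {s\<in>space M. \<forall>i\<in>I. A i s \<in> B i}"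
      using False by auto
    finally show ?thesis .
  qed

  \<comment> \<open>A success has weight \<open>1 / 2\<close>, so the mean is \<open>1 - q / 2\<close> with \<open>q\<close> the success probability.\<close>
  have factor: "expectation (\<lambda>s. f j (A j s)) \<le> exp (- \<epsilon> / 2)" if j: "j \<in> J" for j
  proof -
    have nI: "j \<notin> I" using j disj by blast
    have "expectation (\<lambda>s. f j (A j s)) = 1 - \<P>(s in M. A j s \<in> N) / 2"
      using j nI E_ind[of j N] int_ind[of j N] by (simp add: f_def prob_space)
    also have "\<dots> \<le> 1 + (- \<epsilon> / 2)" using hit[OF j] by simp
    also have "\<dots> \<le> exp (- \<epsilon> / 2)" by (rule exp_ge_add_one_self)
    finally show ?thesis .
  qed

  let ?E = "{s\<in>space M. (\<forall>i\<in>I. A i s \<in> B i) \<and> real (card {j\<in>J. A j s \<in> N}) < \<epsilon> / 2 * card J}"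
  let ?c = "2 powr (\<epsilon> / 2 * card J)"
  let ?F = "\<lambda>s. \<Prod>i\<in>I \<union> J. f i (A i s)"
  \<comment> \<open>This is Markov's inequality before taking expectations: on the event, the weight exceeds \<open>1 / ?c\<close>.\<close>
  have pointwise: "indicator ?E s \<le> ?c * ?F s" for s
  proof (cases "s \<in> ?E")
    case True
    have "(\<Prod>j\<in>J. f j (A j s)) = (\<Prod>j\<in>J. if A j s \<in> N then 1 / 2 else 1)"
      using disj by (intro prod.cong) (auto simp: f_def)
    also have "\<dots> = (1 / 2) ^ card {j\<in>J. A j s \<in> N}"
      using fin(2) by (simp add: prod.If_cases Int_def)
    also have "\<dots> = 2 powr (- real (card {j\<in>J. A j s \<in> N}))"
      by (simp add: powr_minus powr_realpow field_simps)
    finally have "?F s = 2 powr (- real (card {j\<in>J. A j s \<in> N}))"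
      using True fin disj by (simp add: prod.union_disjoint f_def)
    moreover have "1 \<le> ?c * 2 powr (- real (card {j\<in>J. A j s \<in> N}))"
      using True by (simp add: powr_add[symmetric] ge_one_powr_ge_zero)
    ultimately show ?thesis using True by simp
  next
    case False
    then show ?thesis using f_bounds by (simp add: prod_nonneg)
  qed

  have "prob ?E \<le> expectation (\<lambda>s. ?c * ?F s)"
  proof -
    have "?E \<in> events"
      using meas fin(1) by (intro sets.sets_Collect_conj sets.sets_Collect_finite_All
        sets_Collect_count_less fin(2) rv) auto
    then have "prob ?E = expectation (indicator ?E)" by simp
    also have "\<dots> \<le> expectation (\<lambda>s. ?c * ?F s)"
      using pointwise \<open>?E \<in> events\<close> fin f_int
      by (intro integral_mono integrable_mult_right indep_vars_integrable[OF _ f_indep])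
        (auto simp: less_top[symmetric])
    finally show ?thesis .
  qed
  also have "\<dots> = ?c * (\<Prod>i\<in>I \<union> J. expectation (\<lambda>s. f i (A i s)))"
    using fin by (subst integral_mult_right_zero, subst indep_vars_lebesgue_integral[OF _ f_indep f_int]) simp_all
  also have "\<dots> = \<P>(s in M. \<forall>i\<in>I. A i s \<in> B i) * (?c * (\<Prod>j\<in>J. expectation (\<lambda>s. f j (A j s))))"
    using fin disj history by (simp add: prod.union_disjoint)
  also have "\<dots> \<le> \<P>(s in M. \<forall>i\<in>I. A i s \<in> B i) * exp (- \<epsilon> * card J / 8)"
  proof (rule mult_left_mono)
    have "(\<Prod>j\<in>J. expectation (\<lambda>s. f j (A j s))) \<le> (\<Prod>j\<in>J. exp (- \<epsilon> / 2))"
      using factor f_bounds by (intro prod_mono) (auto intro!: integral_nonneg_AE)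
    also have "\<dots> = exp (- \<epsilon> / 2 * card J)"
      by (subst exp_of_nat2_mult) simp
    finally have "?c * (\<Prod>j\<in>J. expectation (\<lambda>s. f j (A j s))) \<le> ?c * exp (- \<epsilon> / 2 * card J)"
      by (intro mult_left_mono) auto
    also have "\<dots> = exp (\<epsilon> * card J * (ln 2 / 2 - 1 / 2))"
      by (simp add: powr_def exp_add[symmetric] algebra_simps)
    also have "\<dots> \<le> exp (\<epsilon> * card J * (- 1 / 8))"
      using False ln2_le_25_over_36 unfolding exp_le_cancel_iff by (intro mult_left_mono) auto
    finally show "?c * (\<Prod>j\<in>J. expectation (\<lambda>s. f j (A j s))) \<le> exp (- \<epsilon> * card J / 8)"
      by simp
  qed simp
  finally show ?thesis by (simp add: mult.commute)
qed

section \<open>Summation over the histories\<close>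

text \<open>
  Here the target set of the later variables is random, the complement of what the earlier ones took.
  It becomes constant once the values \<open>a\<close> of the earlier variables are prescribed, and finiteness of
  \<open>'b\<close> leaves finitely many \<open>a\<close> to sum over.  The family \<open>K\<close> stands for the sets of seen values that
  leave a missing mass above \<open>\<epsilon>\<close>.
\<close>

lemma (in prob_space) few_discoveries_and_missing_mass:
  fixes A :: "'i \<Rightarrow> 'a \<Rightarrow> 'b::finite" and \<epsilon> :: real
  assumes indep: "indep_vars (\<lambda>_. count_space UNIV) A (I \<union> J)"
    and fin: "finite I" "finite J" and disj: "I \<inter> J = {}"
    and missing: "\<And>V j. V \<in> K \<Longrightarrow> j \<in> J \<Longrightarrow> \<epsilon> \<le> \<P>(s in M. A j s \<notin> V)"
  shows "\<P>(s in M. real (card {j\<in>J. A j s \<notin> (\<lambda>i. A i s) ` I}) < \<epsilon> / 2 * card J \<and> (\<lambda>i. A i s) ` I \<in> K)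
    \<le> exp (- \<epsilon> * card J / 8) * \<P>(s in M. (\<lambda>i. A i s) ` I \<in> K)"
proof -
  have rv: "A i \<in> M \<rightarrow>\<^sub>M count_space UNIV" if "i \<in> I \<union> J" for i
    using indep that by (auto simp: indep_vars_def)
  have meas: "{s\<in>space M. A i s \<in> X} \<in> events" if "i \<in> I \<union> J" for i X
    using rv[OF that] by (rule sets_Collect_in)
  \<comment> \<open>The histories are extensional functions, so that each sample point has exactly one.\<close>
  define H where "H = {a \<in> I \<rightarrow>\<^sub>E (UNIV :: 'b set). a ` I \<in> K}"
  define past where "past a = {s\<in>space M. \<forall>i\<in>I. A i s \<in> {a i}}" for a
  define few where
    "few a = {s\<in>space M. (\<forall>i\<in>I. A i s \<in> {a i}) \<and> real (card {j\<in>J. A j s \<in> - a ` I}) < \<epsilon> / 2 * card J}" for a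
  have "finite H" using fin by (simp add: H_def finite_PiE)
  have past_event: "past a \<in> events" for a
    unfolding past_def by (intro sets.sets_Collect_finite_All meas fin) auto
  have few_event: "few a \<in> events" for a
    unfolding few_def by (intro sets.sets_Collect_conj sets.sets_Collect_finite_All
      sets_Collect_count_less meas fin rv) auto
  have same: "(\<lambda>i. A i s) ` I = a ` I" if "s \<in> past a" for s a
    using that by (auto simp: past_def intro!: image_cong)
  have cover: "\<exists>a\<in>H. s \<in> past a" if "s \<in> space M" "(\<lambda>i. A i s) ` I \<in> K" for s
    using that by (intro bexI[of _ "restrict (\<lambda>i. A i s) I"]) (auto simp: past_def H_def)
  have past_disj: "disjoint_family_on past H"
    unfolding disjoint_family_on_def
  proof (intro ballI impI)
    fix a b assume ab: "a \<in> H" "b \<in> H" "a \<noteq> b"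
    then obtain i where "i \<in> I" "a i \<noteq> b i"
      by (auto simp: H_def dest: PiE_ext)
    then show "past a \<inter> past b = {}" by (auto simp: past_def)
  qed
  have few_sub: "few a \<subseteq> past a" for a by (auto simp: few_def past_def)
  then have few_disj: "disjoint_family_on few H"
    using past_disj unfolding disjoint_family_on_def by blast

  have "{s\<in>space M. real (card {j\<in>J. A j s \<notin> (\<lambda>i. A i s) ` I}) < \<epsilon> / 2 * card J \<and> (\<lambda>i. A i s) ` I \<in> K}
      = (\<Union>a\<in>H. few a)" (is "?L = _")
  proof (intro equalityI subsetI)
    fix s assume s: "s \<in> ?L"
    then obtain a where a: "a \<in> H" "s \<in> past a" using cover by blast
    then show "s \<in> (\<Union>a\<in>H. few a)" using s same[OF a(2)] by (auto simp: few_def past_def)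
  next
    fix s assume "s \<in> (\<Union>a\<in>H. few a)"
    then obtain a where a: "a \<in> H" "s \<in> few a" by blast
    then have "(\<lambda>i. A i s) ` I = a ` I" using few_sub same by blast
    then show "s \<in> ?L" using a by (simp add: few_def H_def)
  qed
  then have "prob ?L = (\<Sum>a\<in>H. prob (few a))"
    using \<open>finite H\<close> few_event few_disj by (simp add: finite_measure_finite_Union image_subset_iff)
  also have "\<dots> \<le> (\<Sum>a\<in>H. exp (- \<epsilon> * card J / 8) * prob (past a))"
  proof (rule sum_mono)
    fix a assume "a \<in> H"
    then show "prob (few a) \<le> exp (- \<epsilon> * card J / 8) * prob (past a)"
      unfolding few_def past_def
      by (intro few_hits_given_history[OF indep fin disj]) (auto simp: H_def missing)
  qed
  also have "\<dots> = exp (- \<epsilon> * card J / 8) * prob (\<Union>a\<in>H. past a)"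
    using \<open>finite H\<close> past_event past_disj
    by (simp add: finite_measure_finite_Union image_subset_iff sum_distrib_left)
  also have "(\<Union>a\<in>H. past a) = {s\<in>space M. (\<lambda>i. A i s) ` I \<in> K}"
  proof (intro equalityI subsetI)
    fix s assume "s \<in> (\<Union>a\<in>H. past a)"
    then obtain a where a: "a \<in> H" "s \<in> past a" by blast
    then show "s \<in> {s\<in>space M. (\<lambda>i. A i s) ` I \<in> K}"
      using same[OF a(2)] by (auto simp: H_def past_def)
  qed (use cover in blast)
  finally show ?thesis .
qed

section \<open>The rate of discovery of optimal bases\<close>

lemma bases_prob_eq_measure:
  fixes sel :: "real ^ 'v::finite \<Rightarrow> ('n::finite, 'm::finite) ineq set"
  assumes "prob_space P" and sel: "sel \<in> P \<rightarrow>\<^sub>M count_space UNIV"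
  shows "bases_prob P sel \<U> = \<P>(\<omega> in P. sel \<omega> \<in> \<U>)"
proof -
  interpret P: prob_space P by fact
  have ev: "{\<omega>\<in>space P. sel \<omega> = \<A>} \<in> P.events" for \<A>
    using sets_Collect_in[OF sel, of "{\<A>}"] by simp
  have "bases_prob P sel \<U> = P.prob (\<Union>\<A>\<in>\<U>. {\<omega>\<in>space P. sel \<omega> = \<A>})"
    unfolding bases_prob_def basis_prob_def
    using ev by (intro P.finite_measure_finite_Union[symmetric]) (auto simp: disjoint_family_on_def)
  also have "(\<Union>\<A>\<in>\<U>. {\<omega>\<in>space P. sel \<omega> = \<A>}) = {\<omega>\<in>space P. sel \<omega> \<in> \<U>}" by auto
  finally show ?thesis .
qed

theorem theorem2:
  fixes G :: "('n::finite, 'v::finite, 'm::finite) opf"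
    and P\<^sub>\<omega> :: "(real ^ 'v) measure"
    and sel :: "real ^ 'v \<Rightarrow> ('n, 'm) ineq set"
    and S :: "'s measure"
    and \<omega> :: "nat \<Rightarrow> 's \<Rightarrow> real ^ 'v"
    and \<epsilon> \<delta> :: real
    and M W :: nat
  assumes "uncertainty_distribution G P\<^sub>\<omega>"
    and "tie_breaking_rule G sel"
    and "prob_space S"
    and "prob_space.indep_vars S (\<lambda>_. P\<^sub>\<omega>) \<omega> {1..M + W}"
    and "\<And>i. i \<in> {1..M + W} \<Longrightarrow> distr S P\<^sub>\<omega> (\<omega> i) = P\<^sub>\<omega>"
    and "\<epsilon> > 0" and "\<delta> > 0" and "M > 0" and "W > 0"
    and "\<P>(s in S. bases_prob P\<^sub>\<omega> sel (unobserved G sel M (\<lambda>i. \<omega> i s)) > \<epsilon>) > 0"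
    and "real W > 8 / \<epsilon> * ln (1 / \<delta>)"
  shows "\<P>(s in S. discovery_rate sel M W (\<lambda>i. \<omega> i s) < \<epsilon> / 2
           \<bar> bases_prob P\<^sub>\<omega> sel (unobserved G sel M (\<lambda>i. \<omega> i s)) > \<epsilon>) < \<delta>"
proof -
  note P = assms(1) and tie = assms(2) and indep_\<omega> = assms(4) and law = assms(5)
    and \<epsilon>_pos = assms(6) and \<delta>_pos = assms(7) and W_pos = assms(9)
    and cond_pos = assms(10) and W_large = assms(11)
  interpret S: prob_space S by fact
  have P_prob: "prob_space P\<^sub>\<omega>" and P_sets: "sets P\<^sub>\<omega> = sets (restrict_space borel (recoverable G))"
    using P by (auto simp: uncertainty_distribution_def)
  have sel: "sel \<in> P\<^sub>\<omega> \<rightarrow>\<^sub>M count_space UNIV"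
    using tie measurable_cong_sets[OF P_sets refl] by (auto simp: tie_breaking_rule_def)
  interpret P: prob_space P\<^sub>\<omega> by fact
  have sel_event: "{x\<in>space P\<^sub>\<omega>. sel x \<in> X} \<in> P.events" for X
    using sel by (rule sets_Collect_in)

  define I where "I = {1..M}"
  define J where "J = {M + 1..M + W}"
  have IJ: "I \<union> J = {1..M + W}" "I \<inter> J = {}" "finite I" "finite J" "card J = W"
    by (auto simp: I_def J_def)
  define A where "A i s = sel (\<omega> i s)" for i s
  have indep_A: "S.indep_vars (\<lambda>_. count_space UNIV) A (I \<union> J)"
    using S.indep_vars_compose2[OF indep_\<omega>, of "\<lambda>_. sel" "\<lambda>_. count_space UNIV"] sel
    by (simp add: A_def[abs_def] IJ)

  define K where "K = {V. bases_prob P\<^sub>\<omega> sel (bases G - V) > \<epsilon>}"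
  have unobs: "unobserved G sel M (\<lambda>i. \<omega> i s) = bases G - (\<lambda>i. A i s) ` I" for s
    by (auto simp: unobserved_def A_def I_def)
  have missing: "\<epsilon> \<le> \<P>(s in S. A j s \<notin> V)" if V: "V \<in> K" and j: "j \<in> J" for V j
  proof -
    have j': "j \<in> {1..M + W}" using j IJ(1) by blast
    have rv: "\<omega> j \<in> S \<rightarrow>\<^sub>M P\<^sub>\<omega>"
      using indep_\<omega> j' by (auto simp: S.indep_vars_def)
    have "\<epsilon> < \<P>(x in P\<^sub>\<omega>. sel x \<in> bases G - V)"
      using V by (simp add: K_def bases_prob_eq_measure[OF P_prob sel])
    also have "\<dots> \<le> \<P>(x in P\<^sub>\<omega>. sel x \<in> - V)"
      using sel_event[of "- V"] by (intro P.finite_measure_mono) auto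
    also have "\<dots> = measure (distr S P\<^sub>\<omega> (\<omega> j)) {x\<in>space P\<^sub>\<omega>. sel x \<in> - V}"
      by (simp only: law[OF j'])
    also have "\<dots> = measure S (\<omega> j -` {x\<in>space P\<^sub>\<omega>. sel x \<in> - V} \<inter> space S)"
      using rv sel_event by (rule measure_distr)
    also have "\<omega> j -` {x\<in>space P\<^sub>\<omega>. sel x \<in> - V} \<inter> space S = {s\<in>space S. A j s \<notin> V}"
      using measurable_space[OF rv] by (auto simp: A_def)
    finally show ?thesis by simp
  qed

  have rate: "discovery_rate sel M W (\<lambda>i. \<omega> i s) < \<epsilon> / 2
      \<longleftrightarrow> real (card {j\<in>J. A j s \<notin> (\<lambda>i. A i s) ` I}) < \<epsilon> / 2 * card J" for s
  proof -
    have seen: "(\<Union>j\<in>{1..M}. {sel (\<omega> j s)}) = (\<lambda>i. A i s) ` I" by (auto simp: A_def I_def)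
    have "(\<Sum>i=1..W. if A (M + i) s \<notin> (\<lambda>i. A i s) ` I then 1 else 0 :: real)
        = (\<Sum>j\<in>J. if A j s \<notin> (\<lambda>i. A i s) ` I then 1 else 0)"
      unfolding J_def by (rule sum.reindex_bij_witness[of _ "\<lambda>j. j - M" "\<lambda>i. M + i"]) auto
    also have "\<dots> = card {j\<in>J. A j s \<notin> (\<lambda>i. A i s) ` I}"
      by (subst sum.inter_filter[symmetric]) (simp_all add: IJ(4))
    finally have "discovery_rate sel M W (\<lambda>i. \<omega> i s) = card {j\<in>J. A j s \<notin> (\<lambda>i. A i s) ` I} / real W"
      unfolding discovery_rate_def seen by (simp add: A_def)
    then show ?thesis using W_pos IJ(5) by (simp add: pos_divide_less_eq)
  qed

  have in_K: "bases_prob P\<^sub>\<omega> sel (unobserved G sel M (\<lambda>i. \<omega> i s)) > \<epsilon> \<longleftrightarrow> (\<lambda>i. A i s) ` I \<in> K" for s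
    by (simp add: unobs K_def)
  have "\<P>(s in S. discovery_rate sel M W (\<lambda>i. \<omega> i s) < \<epsilon> / 2
           \<bar> bases_prob P\<^sub>\<omega> sel (unobserved G sel M (\<lambda>i. \<omega> i s)) > \<epsilon>) \<le> exp (- \<epsilon> * W / 8)"
    using S.few_discoveries_and_missing_mass[OF indep_A IJ(3,4,2) missing] cond_pos
    unfolding cond_prob_def in_K rate IJ(5) by (simp add: divide_le_eq)
  also have "exp (- \<epsilon> * W / 8) < exp (ln \<delta>)"
    using W_large \<epsilon>_pos \<delta>_pos unfolding exp_less_cancel_iff by (simp add: ln_div field_simps)
  finally show ?thesis using \<delta>_pos by simp
qed

end
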